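(* Suppose that Assumptions (A1) stability, (A2) strong consistency with regularity, and (A3) boundedness (all spelled out in the context) are satisfied, and let $U_h\subset V_h$ be a linear subspace. Let $(\varepsilon_h,u_h)\in V_h\times U_h$ solve the saddle-point problem $$ \begin{cases} (\varepsilon_h,v_h)_{V_h}+b_h(u_h,v_h)=\langle l_h,v_h\rangle_{V_h^\ast\times V_h}, & \forall\, v_h\in V_h,\\ b_h(z_h,\varepsilon_h)=0, & \forall\, z_h\in U_h, \end{cases} $$ and let $\theta_h\in V_h$ be the unique solution of $b_h(\theta_h,v_h)=\langle l_h,v_h\rangle_{V_h^\ast\times V_h}$ for all $v_h\in V_h$. Then $$ \|\theta_h-u_h\|_{V_h}\le\frac{1}{C_{\mathrm{sta}}}\,\|\varepsilon_h\|_{V_h}. $$ Moreover, if the following saturation assumption is satisfied: there exists a real number $\delta\in[0,1)$, uniform with respect to the mesh size, such that $\|u-\theta_h\|_{V_h}\le\delta\,\|u-u_h\|_{V_h}$, where $u$ is the exact solution of the continuous problem $b(u,v)=\langle l,v\rangle_{Y^\ast,Y}$ for all $v\in Y$, then the following a posteriori error estimate holds: $$ \|u-u_h\|_{V_h}\le\frac{1}{(1-\delta)\,C_{\mathrm{sta}}}\,\|\varepsilon_h\|_{V_h}. $$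
   Context: Continuous problem. $X$ and $Y$ are real Banach spaces, $Y$ reflexive, $b$ is a bounded bilinear form on $X\times Y$, and $l\in Y^\ast$. There is a constant $C_b>0$ with $\inf_{0\ne z\in X}\sup_{0\ne y\in Y}\frac{|b(z,y)|}{\|z\|_X\|y\|_Y}\ge C_b$, and $\{y\in Y: b(z,y)=0\ \forall z\in X\}=\{0\}$. Hence there is a unique $u\in X$ such that $b(u,v)=\langle l,v\rangle_{Y^\ast,Y}$ for all $v\in Y$; $u$ is called the exact solution. Discrete setting. $V_h$ is a finite-dimensional real vector space (of functions on a mesh of size $h$; typically piecewise polynomials), not necessarily contained in $X$ or $Y$; $b_h$ is a bilinear form on $V_h\times V_h$ and $l_h$ is a linear form on $V_h$. $V_h$ is equipped with an inner product $(\cdot,\cdot)_{V_h}$ whose induced norm is $\|\cdot\|_{V_h}$. (A1) Stability: there is a constant $C_{\mathrm{sta}}>0$, uniform with respect to the mesh size, such that $\inf_{0\ne z_h\in V_h}\sup_{0\ne v_h\in V_h}\frac{b_h(z_h,v_h)}{\|z_h\|_{V_h}\|v_h\|_{V_h}}\ge C_{\mathrm{sta}}$. (A2) Strong consistency with regularity: the exact solution $u$ belongs to a subspace $X_\#\subset X$ such that the bilinear form $b_h$ extends to $V_{h,\#}\times V_h$, where $V_{h,\#}:=X_\#+V_h$ (the sum being taken in a common ambient vector space of functions), and $b_h(u,v_h)=\langle l_h,v_h\rangle_{V_h^\ast\times V_h}$ for all $v_h\in V_h$. (A3) Boundedness: the norm $\|\cdot\|_{V_h}$ extends to $V_{h,\#}$,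 and there is a second norm $\|\cdot\|_{V_h,\#}$ on $V_{h,\#}$ such that (i) $\|v\|_{V_h}\le\|v\|_{V_h,\#}$ for all $v\in V_{h,\#}$; (ii) there is a constant $C_{\mathrm{bnd}}<\infty$, uniform with respect to the mesh size, such that $b_h(z,v_h)\le C_{\mathrm{bnd}}\|z\|_{V_h,\#}\|v_h\|_{V_h}$ for all $(z,v_h)\in V_{h,\#}\times V_h$. Under (A1)--(A3), the problem defining $\theta_h$ has exactly one solution. *)

theory Defs
  imports "HOL-Analysis.Analysis"
begin

definition linear_map_on :: "'a::real_vector set \<Rightarrow> ('a \<Rightarrow> 'b::real_vector) \<Rightarrow> bool" where
  "linear_map_on S f \<longleftrightarrow>
     (\<forall>x\<in>S. \<forall>y\<in>S. f (x + y) = f x + f y) \<and> (\<forall>c. \<forall>x\<in>S. f (c *\<^sub>R x) = c *\<^sub>R f x)"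

definition bilinear_form_on ::
  "'a::real_vector set \<Rightarrow> 'b::real_vector set \<Rightarrow> ('a \<Rightarrow> 'b \<Rightarrow> real) \<Rightarrow> bool" where
  "bilinear_form_on S T f \<longleftrightarrow>
     (\<forall>x\<in>S. linear_map_on T (\<lambda>y. f x y)) \<and> (\<forall>y\<in>T. linear_map_on S (\<lambda>x. f x y))"

definition inner_product_on :: "'a::real_vector set \<Rightarrow> ('a \<Rightarrow> 'a \<Rightarrow> real) \<Rightarrow> bool" where
  "inner_product_on S ip \<longleftrightarrow>
     bilinear_form_on S S ip \<and> (\<forall>x\<in>S. \<forall>y\<in>S. ip x y = ip y x) \<and>
     (\<forall>x\<in>S. x \<noteq> 0 \<longrightarrow> ip x x > 0)"

definition ip_norm :: "('a \<Rightarrow> 'a \<Rightarrow> real) \<Rightarrow> 'a \<Rightarrow> real" where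
  "ip_norm ip v = sqrt (ip v v)"

definition norm_on :: "'a::real_vector set \<Rightarrow> ('a \<Rightarrow> real) \<Rightarrow> bool" where
  "norm_on S N \<longleftrightarrow>
     (\<forall>x\<in>S. 0 \<le> N x) \<and> (\<forall>x\<in>S. N x = 0 \<longleftrightarrow> x = 0) \<and>
     (\<forall>c. \<forall>x\<in>S. N (c *\<^sub>R x) = \<bar>c\<bar> * N x) \<and>
     (\<forall>x\<in>S. \<forall>y\<in>S. N (x + y) \<le> N x + N y)"

definition findim_subspace :: "'a::real_vector set \<Rightarrow> bool" where
  "findim_subspace S \<longleftrightarrow> subspace S \<and> (\<exists>B. finite B \<and> span B = S)"

text \<open>Surjectivity of the canonical embedding into the bidual. The type constraint carries the
  space.\<close>

definition reflexive_space :: "'a::real_normed_vector itself \<Rightarrow> bool" where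
  "reflexive_space _ \<longleftrightarrow>
     (\<forall>\<phi> :: ('a \<Rightarrow>\<^sub>L real) \<Rightarrow>\<^sub>L real. \<exists>y. \<forall>f. blinfun_apply \<phi> f = blinfun_apply f y)"

text \<open>The value is extended real, so the infimum over an empty set is \<open>\<infinity>\<close>, the supremum over
  an empty set is \<open>-\<infinity>\<close>, and unbounded suprema are \<open>\<infinity>\<close>.\<close>

definition inf_sup ::
  "'a::zero set \<Rightarrow> 'b::zero set \<Rightarrow> ('a \<Rightarrow> real) \<Rightarrow> ('b \<Rightarrow> real) \<Rightarrow> ('a \<Rightarrow> 'b \<Rightarrow> real) \<Rightarrow> ereal" where
  "inf_sup Z V nZ nV f =
     (INF z\<in>Z - {0}. SUP v\<in>V - {0}. ereal (f z v / (nZ z * nV v)))"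

text \<open>The map \<open>j\<close> places the elements of \<open>X\<^sub>#\<close> in the vector space of functions that also
  contains \<open>V\<close>.\<close>

definition sharp_space :: "('x \<Rightarrow> 'w::real_vector) \<Rightarrow> 'x set \<Rightarrow> 'w set \<Rightarrow> 'w set" where
  "sharp_space j Xs V = {j x + v | x v. x \<in> Xs \<and> v \<in> V}"

end

theory Submission
  imports Defs
begin

text \<open>
  The estimator \<open>\<epsilon>\<^sub>h\<close> is the Riesz representative of the residual of \<open>u\<^sub>h\<close>. Subtracting the first
  saddle-point equation from the equation for \<open>\<theta>\<^sub>h\<close> gives
  \<open>b\<^sub>h(\<theta>\<^sub>h - u\<^sub>h, v) = (\<epsilon>\<^sub>h, v) \<le> \<parallel>\<epsilon>\<^sub>h\<parallel> \<parallel>v\<parallel>\<close> for every \<open>v\<close> in \<open>V\<^sub>h\<close>, by the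
  Cauchy-Schwarz inequality (\<open>inner_product_on_Cauchy_Schwarz\<close>).
  An inf-sup condition turns a bound on the functional \<open>b\<^sub>h(z, \<cdot>)\<close> into a bound on \<open>z\<close>
  (\<open>inf_sup_bound\<close>); with \<open>z = \<theta>\<^sub>h - u\<^sub>h\<close> this is the first estimate.

  For the second estimate, the triangle inequality and saturation give
  \<open>\<parallel>u - u\<^sub>h\<parallel> \<le> \<parallel>u - \<theta>\<^sub>h\<parallel> + \<parallel>\<theta>\<^sub>h - u\<^sub>h\<parallel> \<le> \<delta> \<parallel>u - u\<^sub>h\<parallel> + \<parallel>\<theta>\<^sub>h - u\<^sub>h\<parallel>\<close>, and since
  \<open>\<delta> < 1\<close> the first term on the right can be absorbed on the left.
\<close>

lemma linear_map_on_diff: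
  assumes "linear_map_on S f" "subspace S" "x \<in> S" "y \<in> S"
  shows "f (x - y) = f x - f y"
proof -
  have "(-1) *\<^sub>R y \<in> S"
    using assms(2,4) by (rule subspace_scale)
  with assms(1,3) have "f (x + (-1) *\<^sub>R y) = f x + f ((-1) *\<^sub>R y)"
    unfolding linear_map_on_def by blast
  also have "f ((-1) *\<^sub>R y) = (-1) *\<^sub>R f y"
    using assms(1,4) unfolding linear_map_on_def by blast
  finally show ?thesis by simp
qed

lemma linear_map_on_zero:
  assumes "linear_map_on S f" "subspace S"
  shows "f 0 = 0"
  using linear_map_on_diff[OF assms, of 0 0] assms(2) by (simp add: subspace_0)

lemma linear_map_on_scale:
  "linear_map_on S f \<Longrightarrow> x \<in> S \<Longrightarrow> f (c *\<^sub>R x) = c *\<^sub>R f x"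
  unfolding linear_map_on_def by blast

lemma
  assumes "bilinear_form_on S T f"
  shows bilinear_form_on_left: "y \<in> T \<Longrightarrow> linear_map_on S (\<lambda>x. f x y)"
    and bilinear_form_on_right: "x \<in> S \<Longrightarrow> linear_map_on T (f x)"
  using assms unfolding bilinear_form_on_def by auto

lemma inner_product_on_zero:
  assumes "inner_product_on S ip" "subspace S"
  shows "ip 0 0 = 0"
proof -
  have "bilinear_form_on S S ip"
    using assms(1) unfolding inner_product_on_def by blast
  from linear_map_on_zero[OF bilinear_form_on_right[OF this subspace_0[OF assms(2)]] assms(2)]
  show ?thesis .
qed

lemma inner_product_on_nonneg:
  assumes "inner_product_on S ip" "subspace S" "x \<in> S"
  shows "0 \<le> ip x x"
  using assms inner_product_on_zero[OF assms(1,2)]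
  unfolding inner_product_on_def by (cases "x = 0") (auto intro: less_imp_le)

lemma ip_norm_pos:
  assumes "inner_product_on S ip" "x \<in> S" "x \<noteq> 0"
  shows "0 < ip_norm ip x"
  using assms unfolding inner_product_on_def ip_norm_def by simp

text \<open>
  Positivity of \<open>ip\<close> at \<open>ip y y *\<^sub>R x - ip x y *\<^sub>R y\<close>, which is \<open>ip y y\<close> times the component of
  \<open>x\<close> orthogonal to \<open>y\<close>.
\<close>

lemma inner_product_on_Cauchy_Schwarz:
  assumes ip: "inner_product_on S ip" and S: "subspace S" and x: "x \<in> S" and y: "y \<in> S"
  shows "ip x y \<le> ip_norm ip x * ip_norm ip y"
proof (cases "y = 0")
  case True
  have "bilinear_form_on S S ip"
    using ip unfolding inner_product_on_def by blast
  from linear_map_on_zero[OF bilinear_form_on_right[OF this x] S] have "ip x 0 = 0" .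
  then show ?thesis
    using True inner_product_on_zero[OF ip S] by (simp add: ip_norm_def)
next
  case False
  have bil: "bilinear_form_on S S ip" and sym: "ip y x = ip x y" and pos: "0 < ip y y"
    using ip x y False unfolding inner_product_on_def by auto
  define a c where "a = ip y y" and "c = ip x y"
  define p where "p = a *\<^sub>R x - c *\<^sub>R y"
  have ax: "a *\<^sub>R x \<in> S" and cy: "c *\<^sub>R y \<in> S" and p: "p \<in> S"
    using S x y by (simp_all add: p_def subspace_scale subspace_diff)
  have left: "ip p w = a * ip x w - c * ip y w" if "w \<in> S" for w
    using linear_map_on_diff[OF bilinear_form_on_left[OF bil that] S ax cy]
      linear_map_on_scale[OF bilinear_form_on_left[OF bil that] x]
      linear_map_on_scale[OF bilinear_form_on_left[OF bil that] y]
    by (simp add: p_def)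
  have right: "ip p p = a * ip p x - c * ip p y"
    using linear_map_on_diff[OF bilinear_form_on_right[OF bil p] S ax cy]
      linear_map_on_scale[OF bilinear_form_on_right[OF bil p] x]
      linear_map_on_scale[OF bilinear_form_on_right[OF bil p] y]
    by (simp add: p_def)
  have "ip p p = a * (ip x x * a - c\<^sup>2)"
    unfolding right left[OF x] left[OF y] sym a_def[symmetric] c_def[symmetric]
    by (simp add: algebra_simps power2_eq_square)
  then have "0 \<le> a * (ip x x * a - c\<^sup>2)"
    using inner_product_on_nonneg[OF ip S p] by simp
  then have "c\<^sup>2 \<le> ip x x * a"
    using pos by (simp add: a_def zero_le_mult_iff)
  then have "c \<le> sqrt (ip x x * a)"
    by (rule real_le_rsqrt)
  then show ?thesis
    by (simp add: ip_norm_def a_def c_def real_sqrt_mult)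
qed

text \<open>
  Every quotient in the supremum belonging to \<open>z\<close> is at most \<open>M / nZ z\<close>, and the infimum over
  \<open>z\<close> is at most that supremum.
\<close>

lemma inf_sup_bound:
  assumes inf_sup: "ereal C \<le> inf_sup Z V nZ nV f"
    and z: "z \<in> Z" "z \<noteq> 0" and nz: "0 < nZ z"
    and nV: "\<And>v. v \<in> V \<Longrightarrow> v \<noteq> 0 \<Longrightarrow> 0 < nV v"
    and bound: "\<And>v. v \<in> V \<Longrightarrow> f z v \<le> M * nV v"
  shows "C * nZ z \<le> M"
proof -
  have "ereal C \<le> (SUP v\<in>V - {0}. ereal (f z v / (nZ z * nV v)))"
    using inf_sup z unfolding inf_sup_def by (auto simp: le_INF_iff)
  also have "\<dots> \<le> ereal (M / nZ z)"
  proof (rule SUP_least)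
    fix v assume "v \<in> V - {0}"
    then have "0 < nV v" "f z v \<le> M * nV v"
      using nV bound by auto
    then show "ereal (f z v / (nZ z * nV v)) \<le> ereal (M / nZ z)"
      using nz by (simp add: field_simps)
  qed
  finally show ?thesis
    using nz by (simp add: field_simps)
qed

text \<open>
  The functional \<open>f (\<theta> - w)\<close> is the residual of \<open>w\<close>, and \<open>\<epsilon>\<close> represents it in the inner
  product. By Cauchy-Schwarz its dual norm is at most the norm of \<open>\<epsilon>\<close>, and stability carries this
  bound over to \<open>\<theta> - w\<close>.
\<close>

lemma residual_representative_bounds_error:
  assumes S: "subspace S" and ip: "inner_product_on S ip" and bil: "bilinear_form_on S S f"
    and C: "0 < C" and stable: "ereal C \<le> inf_sup S S (ip_norm ip) (ip_norm ip) f"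
    and mem: "\<epsilon> \<in> S" "w \<in> S" "\<theta> \<in> S"
    and residual: "\<And>v. v \<in> S \<Longrightarrow> ip \<epsilon> v + f w v = f \<theta> v"
  shows "ip_norm ip (\<theta> - w) \<le> 1 / C * ip_norm ip \<epsilon>"
proof (cases "\<theta> = w")
  case True
  then show ?thesis
    using inner_product_on_zero[OF ip S] inner_product_on_nonneg[OF ip S mem(1)] C
    by (simp add: ip_norm_def)
next
  case False
  have e: "\<theta> - w \<in> S" "\<theta> - w \<noteq> 0"
    using S mem False by (simp_all add: subspace_diff)
  have "f (\<theta> - w) v \<le> ip_norm ip \<epsilon> * ip_norm ip v" if v: "v \<in> S" for v
    using linear_map_on_diff[OF bilinear_form_on_left[OF bil v] S mem(3,2)] residual[OF v]
      inner_product_on_Cauchy_Schwarz[OF ip S mem(1) v]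
    by simp
  then have "C * ip_norm ip (\<theta> - w) \<le> ip_norm ip \<epsilon>"
    by (intro inf_sup_bound[OF stable e ip_norm_pos[OF ip e]])
      (auto intro: ip_norm_pos[OF ip])
  then show ?thesis
    using C by (simp add: field_simps)
qed

theorem proposition2:
  fixes b :: "'x::banach \<Rightarrow> 'y::banach \<Rightarrow> real"
    and l :: "'y \<Rightarrow>\<^sub>L real"
    and Cb :: real
    and u :: 'x
    and H :: "real set"
    and V :: "real \<Rightarrow> 'w::real_vector set"
    and ip :: "real \<Rightarrow> 'w \<Rightarrow> 'w \<Rightarrow> real"
    and bh :: "real \<Rightarrow> 'w \<Rightarrow> 'w \<Rightarrow> real"
    and lh :: "real \<Rightarrow> 'w \<Rightarrow> real"
    and Xs :: "'x set"
    and j :: "'x \<Rightarrow> 'w"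
    and bs :: "real \<Rightarrow> 'w \<Rightarrow> 'w \<Rightarrow> real"
    and N Ns :: "real \<Rightarrow> 'w \<Rightarrow> real"
    and Csta Cbnd :: real
    and U :: "real \<Rightarrow> 'w set"
    and \<epsilon>h uh \<theta>h :: "real \<Rightarrow> 'w"
  assumes Y_reflexive: "reflexive_space TYPE('y)"
    and b_bounded: "bounded_bilinear b"
    and Cb_pos: "Cb > 0"
    and b_inf_sup: "inf_sup UNIV UNIV norm norm (\<lambda>z y. \<bar>b z y\<bar>) \<ge> ereal Cb"
    and b_nondeg: "{y. \<forall>z. b z y = 0} = {0}"
    and u_exact: "\<And>v. b u v = blinfun_apply l v"
    \<comment> \<open>discrete setting, for every mesh size \<open>h\<close>\<close>
    and mesh_sizes: "H \<subseteq> {0<..}"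
    and V_findim: "\<And>h. h \<in> H \<Longrightarrow> findim_subspace (V h)"
    and ip_inner: "\<And>h. h \<in> H \<Longrightarrow> inner_product_on (V h) (ip h)"
    and bh_bilinear: "\<And>h. h \<in> H \<Longrightarrow> bilinear_form_on (V h) (V h) (bh h)"
    and lh_linear: "\<And>h. h \<in> H \<Longrightarrow> linear_map_on (V h) (lh h)"
    \<comment> \<open>(A1)\<close>
    and Csta_pos: "Csta > 0"
    and stability: "\<And>h. h \<in> H \<Longrightarrow>
      inf_sup (V h) (V h) (ip_norm (ip h)) (ip_norm (ip h)) (bh h) \<ge> ereal Csta"
    \<comment> \<open>(A2)\<close>
    and Xs_subspace: "subspace Xs"
    and j_linear: "linear_map_on Xs j"
    and j_inj: "inj_on j Xs"
    and u_in_Xs: "u \<in> Xs"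
    and bs_bilinear: "\<And>h. h \<in> H \<Longrightarrow> bilinear_form_on (sharp_space j Xs (V h)) (V h) (bs h)"
    and bs_extends: "\<And>h z v. h \<in> H \<Longrightarrow> z \<in> V h \<Longrightarrow> v \<in> V h \<Longrightarrow> bs h z v = bh h z v"
    and consistency: "\<And>h v. h \<in> H \<Longrightarrow> v \<in> V h \<Longrightarrow> bs h (j u) v = lh h v"
    \<comment> \<open>(A3)\<close>
    and N_norm: "\<And>h. h \<in> H \<Longrightarrow> norm_on (sharp_space j Xs (V h)) (N h)"
    and N_extends: "\<And>h v. h \<in> H \<Longrightarrow> v \<in> V h \<Longrightarrow> N h v = ip_norm (ip h) v"
    and Ns_norm: "\<And>h. h \<in> H \<Longrightarrow> norm_on (sharp_space j Xs (V h)) (Ns h)"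
    and N_le_Ns: "\<And>h v. h \<in> H \<Longrightarrow> v \<in> sharp_space j Xs (V h) \<Longrightarrow> N h v \<le> Ns h v"
    and boundedness: "\<And>h z v. h \<in> H \<Longrightarrow> z \<in> sharp_space j Xs (V h) \<Longrightarrow> v \<in> V h \<Longrightarrow>
      bs h z v \<le> Cbnd * Ns h z * ip_norm (ip h) v"
    \<comment> \<open>the saddle-point problem and \<open>\<theta>\<^sub>h\<close>\<close>
    and U_subspace: "\<And>h. h \<in> H \<Longrightarrow> subspace (U h) \<and> U h \<subseteq> V h"
    and \<epsilon>h_in: "\<And>h. h \<in> H \<Longrightarrow> \<epsilon>h h \<in> V h"
    and uh_in: "\<And>h. h \<in> H \<Longrightarrow> uh h \<in> U h"
    and saddle1: "\<And>h v. h \<in> H \<Longrightarrow> v \<in> V h \<Longrightarrow> ip h (\<epsilon>h h) v + bh h (uh h) v = lh h v"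
    and saddle2: "\<And>h z. h \<in> H \<Longrightarrow> z \<in> U h \<Longrightarrow> bh h z (\<epsilon>h h) = 0"
    and \<theta>h_in: "\<And>h. h \<in> H \<Longrightarrow> \<theta>h h \<in> V h"
    and \<theta>h_solves: "\<And>h v. h \<in> H \<Longrightarrow> v \<in> V h \<Longrightarrow> bh h (\<theta>h h) v = lh h v"
  shows "(\<forall>h\<in>H. ip_norm (ip h) (\<theta>h h - uh h) \<le> 1 / Csta * ip_norm (ip h) (\<epsilon>h h)) \<and>
    (\<forall>\<delta>::real. 0 \<le> \<delta> \<and> \<delta> < 1 \<and> (\<forall>h\<in>H. N h (j u - \<theta>h h) \<le> \<delta> * N h (j u - uh h)) \<longrightarrow>
      (\<forall>h\<in>H. N h (j u - uh h) \<le> 1 / ((1 - \<delta>) * Csta) * ip_norm (ip h) (\<epsilon>h h)))"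
proof -
  have subsp: "subspace (V h)" and uh_V: "uh h \<in> V h" if "h \<in> H" for h
    using V_findim[OF that] U_subspace[OF that] uh_in[OF that]
    by (auto simp: findim_subspace_def)
  have discrete_error: "ip_norm (ip h) (\<theta>h h - uh h) \<le> 1 / Csta * ip_norm (ip h) (\<epsilon>h h)"
    if h: "h \<in> H" for h
    by (rule residual_representative_bounds_error[OF subsp[OF h] ip_inner[OF h] bh_bilinear[OF h]
          Csta_pos stability[OF h] \<epsilon>h_in[OF h] uh_V[OF h] \<theta>h_in[OF h]])
      (simp add: h saddle1 \<theta>h_solves)
  have exact_error: "N h (j u - uh h) \<le> 1 / ((1 - \<delta>) * Csta) * ip_norm (ip h) (\<epsilon>h h)"
    if h: "h \<in> H" and \<delta>: "\<delta> < 1"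
      and saturation: "N h (j u - \<theta>h h) \<le> \<delta> * N h (j u - uh h)" for \<delta> h
  proof -
    have d_V: "\<theta>h h - uh h \<in> V h" and m_V: "- \<theta>h h \<in> V h"
      using subsp[OF h] \<theta>h_in[OF h] uh_V[OF h] by (simp_all add: subspace_diff subspace_neg)
    have "j u + (- \<theta>h h) \<in> sharp_space j Xs (V h)"
      using u_in_Xs m_V unfolding sharp_space_def by blast
    then have "j u - \<theta>h h \<in> sharp_space j Xs (V h)"
      by simp
    \<comment> \<open>writing \<open>0\<close> as \<open>j 0\<close> puts an element of \<open>V\<^sub>h\<close> in the form required of the sum\<close>
    moreover have "j 0 + (\<theta>h h - uh h) \<in> sharp_space j Xs (V h)"
      using subspace_0[OF Xs_subspace] d_V unfolding sharp_space_def by blast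
    then have "\<theta>h h - uh h \<in> sharp_space j Xs (V h)"
      by (simp add: linear_map_on_zero[OF j_linear Xs_subspace])
    ultimately have
      "N h ((j u - \<theta>h h) + (\<theta>h h - uh h)) \<le> N h (j u - \<theta>h h) + N h (\<theta>h h - uh h)"
      using N_norm[OF h] unfolding norm_on_def by blast
    then have "(1 - \<delta>) * N h (j u - uh h) \<le> ip_norm (ip h) (\<theta>h h - uh h)"
      using saturation N_extends[OF h d_V] by (simp add: algebra_simps)
    also have "\<dots> \<le> 1 / Csta * ip_norm (ip h) (\<epsilon>h h)"
      by (rule discrete_error[OF h])
    finally have "N h (j u - uh h) \<le> (1 / Csta * ip_norm (ip h) (\<epsilon>h h)) / (1 - \<delta>)"
      using \<delta> by (subst pos_le_divide_eq) (auto simp only: mult.commute diff_gt_0_iff_gt)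
    then show ?thesis
      by (simp add: mult.commute)
  qed
  show ?thesis
  proof (intro conjI allI ballI impI)
    show "ip_norm (ip h) (\<theta>h h - uh h) \<le> 1 / Csta * ip_norm (ip h) (\<epsilon>h h)"
      if "h \<in> H" for h
      by (rule discrete_error[OF that])
  next
    fix \<delta> h
    assume "0 \<le> \<delta> \<and> \<delta> < 1 \<and> (\<forall>h\<in>H. N h (j u - \<theta>h h) \<le> \<delta> * N h (j u - uh h))"
      and h: "h \<in> H"
    then have "\<delta> < 1" and "N h (j u - \<theta>h h) \<le> \<delta> * N h (j u - uh h)"
      using h by blast+
    then show "N h (j u - uh h) \<le> 1 / ((1 - \<delta>) * Csta) * ip_norm (ip h) (\<epsilon>h h)"
      by (rule exact_error[OF h])
  qed
qed

end
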